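(* Let $\Sigma$ be a finite CW complex of dimension $d$ and let $\Upsilon=\{\sigma_1,\dots,\sigma_r\}$ be a cellular spanning forest of $\Sigma$. For $\sigma=\sigma_i\in\Upsilon$ define $$\bar\chi(\Upsilon,\sigma)=\sum_{j=1}^r(-1)^j\big(\det L^{\mathrm{du}}_{\Upsilon\setminus\sigma,\ \Upsilon\setminus\sigma_j}\big)\,L^{\mathrm{du}}\sigma_j\ \in C_d(\Sigma;\mathbb{R}).$$ Then $\{\bar\chi(\Upsilon,\sigma):\sigma\in\Upsilon\}$ is an $\mathbb{R}$-vector space basis of the cut space $\operatorname{Cut}_d(\Sigma)=\operatorname{im}(\partial_d^*:C_{d-1}(\Sigma;\mathbb{R})\to C_d(\Sigma;\mathbb{R}))$.
   Context: $\Sigma$ has the convention of a unique $(-1)$-cell; $d$-cells are facets; cells are oriented and $\partial_d$ is the cellular boundary map with transpose $\partial_d^*$; $r=\operatorname{rank}\partial_d$. A cellular spanning forest (CSF) is a subcomplex $\Upsilon$ containing the full $(d-1)$-skeleton of $\Sigma$, identified with its set of facets, whose facets index a basis of the column space of $\partial_d$ over $\mathbb{R}$ (so $|\Upsilon|=r$). $L^{\mathrm{du}}=\partial_d^*\partial_d$ is the down-up Laplacian on $C_d(\Sigma;\mathbb{R})$, a matrix indexed by facets; $L^{\mathrm{du}}_{X,Y}$ is its submatrix with rows $X$ and columns $Y$, both ordered by the indexing $\sigma_1,\dots,\sigma_r$; facets are identified with basis vectors of $C_d(\Sigma;\mathbb{R})$. *)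

theory Defs
  imports
    "HOL-Analysis.Analysis"
    "HOL-Homology.Homology"
    "Jordan_Normal_Form.Determinant"
begin

section \<open>Finite CW complexes\<close>

definition disc :: "nat \<Rightarrow> (nat \<Rightarrow> real) topology" where
  "disc n = subtopology (Euclidean_space n) {x. (\<Sum>i<n. (x i)\<^sup>2) \<le> 1}"

definition open_disc :: "nat \<Rightarrow> (nat \<Rightarrow> real) topology" where
  "open_disc n = subtopology (Euclidean_space n) {x. (\<Sum>i<n. (x i)\<^sup>2) < 1}"

text \<open>All elements of the finite type of cells are cells of the complex, including the unique
  \<open>(-1)\<close>-cell (the empty cell), for which \<open>char_map\<close> is irrelevant.  The orientation of a cell
  is recorded as a sign: \<open>1\<close> if it is the orientation transported from the disc by the
  characteristic map, \<open>-1\<close> if it is the opposite one.\<close>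

record ('a, 'c) cw =
  cw_space :: "'a topology"
  cell_dim :: "'c \<Rightarrow> int"
  char_map :: "'c \<Rightarrow> (nat \<Rightarrow> real) \<Rightarrow> 'a"
  orient :: "'c \<Rightarrow> int"

definition open_cell :: "('a, 'c) cw \<Rightarrow> 'c \<Rightarrow> 'a set" where
  "open_cell K e =
     (if cell_dim K e < 0 then {} else char_map K e ` topspace (open_disc (nat (cell_dim K e))))"

definition closed_cell :: "('a, 'c) cw \<Rightarrow> 'c \<Rightarrow> 'a set" where
  "closed_cell K e =
     (if cell_dim K e < 0 then {} else char_map K e ` topspace (disc (nat (cell_dim K e))))"

text \<open>No condition for the weak topology is needed, since there are only finitely many cells.\<close>

definition finite_CW_complex :: "('a, 'c::finite) cw \<Rightarrow> bool" where
  "finite_CW_complex K \<longleftrightarrow>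
     Hausdorff_space (cw_space K) \<and>
     (\<forall>e. cell_dim K e \<ge> -1) \<and>
     (\<exists>!e. cell_dim K e = -1) \<and>
     (\<forall>e. orient K e \<in> {1, -1}) \<and>
     (\<forall>e. cell_dim K e \<ge> 0 \<longrightarrow>
        continuous_map (disc (nat (cell_dim K e))) (cw_space K) (char_map K e) \<and>
        embedding_map (open_disc (nat (cell_dim K e))) (cw_space K) (char_map K e) \<and>
        char_map K e ` (topspace (disc (nat (cell_dim K e))) - topspace (open_disc (nat (cell_dim K e))))
          \<subseteq> (\<Union>e' \<in> {e'. cell_dim K e' < cell_dim K e}. open_cell K e')) \<and>
     (\<forall>e e'. e \<noteq> e' \<longrightarrow> open_cell K e \<inter> open_cell K e' = {}) \<and>
     (\<Union>e. open_cell K e) = topspace (cw_space K)"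

definition cw_dim :: "('a, 'c::finite) cw \<Rightarrow> int" where
  "cw_dim K = Max (range (cell_dim K))"

definition cells :: "('a, 'c) cw \<Rightarrow> int \<Rightarrow> 'c set" where
  "cells K k = {e. cell_dim K e = k}"

definition subcomplex :: "('a, 'c) cw \<Rightarrow> 'c set \<Rightarrow> bool" where
  "subcomplex K S \<longleftrightarrow> (\<forall>e\<in>S. closed_cell K e \<subseteq> (\<Union>e'\<in>S. open_cell K e'))"


section \<open>The cellular boundary map\<close>

text \<open>The standard identification of the disc modulo its boundary sphere with the sphere of the
  same dimension \<open>n\<close>: the boundary goes to the pole with last coordinate \<open>-1\<close>, and the
  open disc is mapped homeomorphically onto the complement of that pole.\<close>

definition disc_to_sphere :: "nat \<Rightarrow> (nat \<Rightarrow> real) \<Rightarrow> nat \<Rightarrow> real" where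
  "disc_to_sphere n x =
     (let t = (\<Sum>i<n. (x i)\<^sup>2) in
      (\<lambda>i. if i < n then 2 * sqrt (1 - t) * x i else if i = n then 1 - 2 * t else 0))"

text \<open>For a cell \<open>e\<close> of dimension \<open>n\<close>, the map from the \<open>n\<close>-skeleton to the \<open>n\<close>-sphere that
  collapses the complement of the open cell \<open>e\<close> to a point.\<close>

definition collapse :: "('a, 'c) cw \<Rightarrow> 'c \<Rightarrow> 'a \<Rightarrow> nat \<Rightarrow> real" where
  "collapse K e z =
     (let n = nat (cell_dim K e) in
      if z \<in> open_cell K e
      then disc_to_sphere n (inv_into (topspace (open_disc n)) (char_map K e) z)
      else (\<lambda>i. if i = n then -1 else 0))"

text \<open>The coefficient of \<open>e'\<close> in the cellular boundary of \<open>e\<close>, where \<open>e\<close> has dimension one more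
  than \<open>e'\<close>: the degree of the attaching map of \<open>e\<close> followed by the collapse onto \<open>e'\<close>.  If
  \<open>e'\<close> is the \<open>(-1)\<close>-cell, this is the augmentation.\<close>

definition incidence :: "('a, 'c) cw \<Rightarrow> 'c \<Rightarrow> 'c \<Rightarrow> int" where
  "incidence K e e' =
     orient K e * orient K e' *
     (if cell_dim K e' < 0 then 1
      else Brouwer_degree2 (nat (cell_dim K e')) (collapse K e' \<circ> char_map K e))"

text \<open>The cells of all dimensions index the coordinates of \<open>real ^ 'c\<close>, with \<open>axis e 1\<close> the
  basis vector of the cell \<open>e\<close>; the chain groups are coordinate subspaces.  Accordingly, the
  matrix of the boundary map in degree \<open>k\<close> is extended by zero outside the rows indexed by
  \<open>(k-1)\<close>-cells and the columns indexed by \<open>k\<close>-cells.\<close>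

definition chains :: "('a, 'c::finite) cw \<Rightarrow> int \<Rightarrow> (real ^ 'c) set" where
  "chains K k = span ((\<lambda>e. axis e 1) ` cells K k)"

definition boundary :: "('a, 'c::finite) cw \<Rightarrow> int \<Rightarrow> real ^ 'c ^ 'c" where
  "boundary K k = (\<chi> e' e. if e \<in> cells K k \<and> e' \<in> cells K (k - 1)
                          then real_of_int (incidence K e e') else 0)"

definition Cut :: "('a, 'c::finite) cw \<Rightarrow> int \<Rightarrow> (real ^ 'c) set" where
  "Cut K k = (\<lambda>x. Finite_Cartesian_Product.transpose (boundary K k) *v x) ` chains K (k - 1)"

definition Ldu :: "('a, 'c::finite) cw \<Rightarrow> int \<Rightarrow> real ^ 'c ^ 'c" where
  "Ldu K k = Finite_Cartesian_Product.transpose (boundary K k) ** boundary K k"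


section \<open>Cellular spanning forests and the vectors of the cut basis\<close>

definition indexed_basis :: "'i set \<Rightarrow> ('i \<Rightarrow> 'v::real_vector) \<Rightarrow> 'v set \<Rightarrow> bool" where
  "indexed_basis I f V \<longleftrightarrow> inj_on f I \<and> independent (f ` I) \<and> span (f ` I) = V"

definition cellular_spanning_forest :: "('a, 'c::finite) cw \<Rightarrow> 'c set \<Rightarrow> bool" where
  "cellular_spanning_forest K S \<longleftrightarrow>
     subcomplex K S \<and> {e. cell_dim K e < cw_dim K} \<subseteq> S \<and>
     indexed_basis (S \<inter> cells K (cw_dim K)) (\<lambda>e. column e (boundary K (cw_dim K)))
       (span (columns (boundary K (cw_dim K))))"

text \<open>The submatrix of \<open>L\<close> with rows \<open>X\<close> and columns \<open>Y\<close>, both ordered as in the list \<open>xs\<close>.\<close>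

definition submatrix_along :: "'c list \<Rightarrow> real ^ 'c ^ 'c \<Rightarrow> 'c set \<Rightarrow> 'c set \<Rightarrow> real mat" where
  "submatrix_along xs L X Y =
     (let rs = filter (\<lambda>x. x \<in> X) xs; cs = filter (\<lambda>x. x \<in> Y) xs
      in Matrix.mat (length rs) (length cs) (\<lambda>(a, b). L $ (rs ! a) $ (cs ! b)))"

text \<open>Here \<open>\<sigma>\<close> enumerates the facets of the forest as \<open>\<sigma> 1, \<dots>, \<sigma> r\<close>.\<close>

definition chi_bar :: "('a, 'c::finite) cw \<Rightarrow> int \<Rightarrow> nat \<Rightarrow> (nat \<Rightarrow> 'c) \<Rightarrow> 'c \<Rightarrow> real ^ 'c" where
  "chi_bar K k r \<sigma> \<tau> =
     (let \<Upsilon> = \<sigma> ` {1..r}; L = Ldu K k in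
      \<Sum>j=1..r. ((-1) ^ j *
                  Determinant.det
                    (submatrix_along (map \<sigma> [1..<Suc r]) L (\<Upsilon> - {\<tau>}) (\<Upsilon> - {\<sigma> j})))
               *\<^sub>R (L *v axis (\<sigma> j) 1))"

end

theory Submission
  imports Defs
begin

text \<open>Let \<open>A\<close> be the submatrix of the down-up Laplacian with rows and columns in the forest.  It is
  the Gram matrix of the linearly independent columns of the boundary map indexed by the forest,
  so it is invertible.  Up to sign, the coordinates of the \<open>i\<close>-th vector at the facets of the
  forest are the entries of \<open>A\<close> times the \<open>i\<close>-th column of its adjugate: they vanish except at
  \<open>\<sigma>\<^sub>i\<close>, where the coordinate is \<open>det A\<close> up to sign.  Hence the \<open>r\<close> vectors are independent, and
  they lie in the cut space, whose dimension is at most \<open>r\<close>.\<close>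

lemma filter_minus_nth:
  assumes "distinct xs" "i < length xs"
  shows "filter (\<lambda>x. x \<in> set xs - {xs ! i}) xs = take i xs @ drop (Suc i) xs"
proof -
  have xs: "xs = take i xs @ xs ! i # drop (Suc i) xs"
    using assms(2) by (rule id_take_nth_drop)
  then have "distinct (take i xs @ xs ! i # drop (Suc i) xs)"
    using assms(1) by simp
  then have notin: "xs ! i \<notin> set (take i xs)" "xs ! i \<notin> set (drop (Suc i) xs)"
    by auto
  have "filter (\<lambda>x. x \<in> set xs - {xs ! i}) xs = filter (\<lambda>x. x \<noteq> xs ! i) xs"
    by (rule filter_cong) auto
  also have "\<dots> = filter (\<lambda>x. x \<noteq> xs ! i) (take i xs @ xs ! i # drop (Suc i) xs)"
    using xs by simp
  also have "\<dots> = take i xs @ drop (Suc i) xs"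
    using notin filter_True[of "take i xs" "\<lambda>x. x \<noteq> xs ! i"]
      filter_True[of "drop (Suc i) xs" "\<lambda>x. x \<noteq> xs ! i"]
    by fastforce
  finally show ?thesis .
qed

lemma submatrix_along_carrier:
  "submatrix_along xs L (set xs) (set xs) \<in> carrier_mat (length xs) (length xs)"
  by (simp add: submatrix_along_def Let_def)

lemma submatrix_along_index:
  assumes "i < length xs" "j < length xs"
  shows "submatrix_along xs L (set xs) (set xs) $$ (i, j) = L $ (xs ! i) $ (xs ! j)"
  using assms by (simp add: submatrix_along_def Let_def)

text \<open>Turns the minors in \<open>chi_bar\<close>, whose rows and columns are selected by sets
  of facets, into \<open>mat_delete\<close>, so that cofactors and the adjugate apply. Distinctness
  of \<open>xs\<close> makes removing an element the same as removing one position.\<close>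

lemma submatrix_along_delete:
  assumes "distinct xs" "i < length xs" "j < length xs"
  shows "submatrix_along xs L (set xs - {xs ! i}) (set xs - {xs ! j}) =
    mat_delete (submatrix_along xs L (set xs) (set xs)) i j"
proof -
  have nth_delete: "(take k xs @ drop (Suc k) xs) ! a = xs ! (if a < k then a else Suc a)"
    if "k < length xs" "a < length xs - 1" for k a
    using that by (auto simp: nth_append min_def)
  show ?thesis
    unfolding submatrix_along_def Let_def
      filter_minus_nth[OF assms(1,2)] filter_minus_nth[OF assms(1,3)]
    by (rule eq_matI) (use assms in \<open>auto simp: mat_delete_def nth_delete min_def\<close>)
qed

text \<open>A kernel vector of the submatrix, extended by zero to \<open>x\<close>, satisfies |Mx|^2
  = 0, so its entries are the coefficients of a linear relation between the chosen columns of
  \<open>M\<close>.\<close>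

lemma gram_submatrix_det_nonzero:
  fixes M :: "real ^ 'n ^ 'm"
  assumes xs: "distinct xs"
    and inj: "inj_on (\<lambda>e. column e M) (set xs)"
    and indep: "independent ((\<lambda>e. column e M) ` set xs)"
  shows "Determinant.det (submatrix_along xs (Finite_Cartesian_Product.transpose M ** M)
    (set xs) (set xs)) \<noteq> 0"
proof
  define L where "L = Finite_Cartesian_Product.transpose M ** M"
  define A where "A = submatrix_along xs L (set xs) (set xs)"
  let ?n = "length xs"
  have A: "A \<in> carrier_mat ?n ?n"
    unfolding A_def by (rule submatrix_along_carrier)
  assume "Determinant.det (submatrix_along xs (Finite_Cartesian_Product.transpose M ** M)
    (set xs) (set xs)) = 0"
  then have "Determinant.det A = 0"
    by (simp add: A_def L_def)
  then obtain v where v: "v \<in> carrier_vec ?n" "v \<noteq> 0\<^sub>v ?n" "A *\<^sub>v v = 0\<^sub>v ?n"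
    using det_0_iff_vec_prod_zero_field[OF A] by blast
  \<comment> \<open>The extension of \<open>v\<close> by zero to the coordinates outside
    \<open>xs\<close>.\<close>
  define x :: "real ^ 'n" where "x = (\<Sum>j<?n. vec_index v j *\<^sub>R axis (xs ! j) 1)"
  have "(L *v x) $ (xs ! i) = 0" if "i < ?n" for i
  proof -
    have "(L *v x) $ (xs ! i) = (\<Sum>j<?n. vec_index v j * L $ (xs ! i) $ (xs ! j))"
      by (simp add: x_def linear_sum[OF matrix_vector_mul_linear]
          linear_scale[OF matrix_vector_mul_linear] matrix_vector_mult_basis column_def)
    also have "\<dots> = vec_index (A *\<^sub>v v) i"
      using that A v(1)
      by (auto simp: scalar_prod_def atLeast0LessThan A_def submatrix_along_index
          submatrix_along_def Let_def intro!: sum.cong)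
    finally show ?thesis
      using v(3) that by simp
  qed
  \<comment> \<open>\<open>L *v x\<close> may be nonzero outside \<open>xs\<close>, but
    \<open>x\<close> vanishes there.\<close>
  then have "x \<bullet> (L *v x) = 0"
    by (simp add: x_def inner_sum_left inner_axis_axis inner_axis')
  moreover have "x \<bullet> (L *v x) = (M *v x) \<bullet> (M *v x)"
    unfolding L_def
    by (metis dot_lmul_matrix matrix_vector_mul_assoc transpose_matrix_vector inner_commute)
  ultimately have "M *v x = 0"
    by simp
  then have "(\<Sum>j<?n. vec_index v j *\<^sub>R column (xs ! j) M) = 0"
    by (simp add: x_def linear_sum[OF matrix_vector_mul_linear]
        linear_scale[OF matrix_vector_mul_linear] matrix_vector_mult_basis)
  moreover have bij: "bij_betw ((!) xs) {..<?n} (set xs)"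
    using xs by (rule bij_betw_nth) auto
  then have inj': "inj_on (\<lambda>j. column (xs ! j) M) {..<?n}"
    using comp_inj_on[of "(!) xs" "{..<?n}" "\<lambda>e. column e M"] inj
    by (simp add: bij_betw_def o_def)
  moreover have "independent ((\<lambda>j. column (xs ! j) M) ` {..<?n})"
    using indep by (simp add: image_image flip: bij_betw_imp_surj_on[OF bij])
  ultimately have "vec_index v j = 0" if "j < ?n" for j
  proof -
    let ?f = "\<lambda>j. column (xs ! j) M"
    \<comment> \<open>Independence concerns a set of vectors, so the coefficients are carried from
      positions to columns; \<open>inj'\<close> makes this unambiguous.\<close>
    define u where "u = (\<lambda>w. vec_index v (inv_into {..<?n} ?f w))"
    assume ind: "independent (?f ` {..<?n})" and z: "(\<Sum>j<?n. vec_index v j *\<^sub>R ?f j) = 0"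
    have u: "u (?f k) = vec_index v k" if "k < ?n" for k
      using inv_into_f_f[OF inj', of k] that by (simp add: u_def)
    have "(\<Sum>w\<in>?f ` {..<?n}. u w *\<^sub>R w) = (\<Sum>k<?n. u (?f k) *\<^sub>R ?f k)"
      using inj' by (simp add: sum.reindex)
    also have "\<dots> = 0"
      using z u by simp
    finally have "u (?f j) = 0"
      using ind that independentD[of "?f ` {..<?n}" "?f ` {..<?n}" u "?f j"] by blast
    then show ?thesis using u that by simp
  qed
  then have "v = 0\<^sub>v ?n"
    using v(1) by (intro eq_vecI) auto
  then show False
    using v(2) by simp
qed

text \<open>This is one entry of the identity A adj(A) = det(A) I. For \<open>i\<close> different
  from \<open>k\<close> the sum is the determinant of \<open>A\<close> with row \<open>i\<close>
  replaced by row \<open>k\<close>, hence with two equal rows.\<close>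

lemma row_times_cofactors:
  fixes A :: "'a::comm_ring_1 mat"
  assumes "A \<in> carrier_mat n n" "i < n" "k < n"
  shows "(\<Sum>j<n. A $$ (k, j) * cofactor A i j) = (if i = k then Determinant.det A else 0)"
proof -
  have "(\<Sum>j<n. A $$ (k, j) * cofactor A i j) = (A * adj_mat A) $$ (k, i)"
    using assms by (auto simp: adj_mat_def scalar_prod_def atLeast0LessThan intro!: sum.cong)
  also have "\<dots> = (if i = k then Determinant.det A else 0)"
    using assms adj_mat(2)[OF assms(1)] by auto
  finally show ?thesis .
qed

text \<open>At \<open>\<sigma> k\<close> the \<open>j\<close>-th summand is, up to sign, the entry
  \<open>(k, j)\<close> of the forest submatrix times its cofactor at \<open>(i, j)\<close>, so the
  sum pairs row \<open>k\<close> with the cofactors of row \<open>i\<close>.\<close>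

lemma chi_bar_coordinates:
  assumes inj: "inj_on \<sigma> {1..r}" and i: "i \<in> {1..r}" and k: "k \<in> {1..r}"
  shows "chi_bar K d r \<sigma> (\<sigma> i) $ (\<sigma> k) =
    (if k = i then (-1) ^ i * Determinant.det (submatrix_along (map \<sigma> [1..<Suc r]) (Ldu K d)
       (\<sigma> ` {1..r}) (\<sigma> ` {1..r})) else 0)"
proof -
  define xs where "xs = map \<sigma> [1..<Suc r]"
  define L where "L = Ldu K d"
  define A where "A = submatrix_along xs L (set xs) (set xs)"
  have set: "set xs = \<sigma> ` {1..r}" and len: "length xs = r"
    by (auto simp: xs_def)
  have dist: "distinct xs"
    using inj by (simp add: xs_def distinct_map atLeastLessThanSuc_atLeastAtMost del: upt_Suc)
  have nth: "xs ! a = \<sigma> (Suc a)" if "a < r" for a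
    using that by (simp add: xs_def del: upt_Suc)
  have A: "A \<in> carrier_mat r r"
    using submatrix_along_carrier[of xs L] by (simp add: A_def len)
  obtain a where a: "i = Suc a" "a < r"
    using i by (cases i) auto
  obtain b where b: "k = Suc b" "b < r"
    using k by (cases k) auto
  \<comment> \<open>Facets are numbered from 1 and matrix positions from 0. The sign in
    \<open>chi_bar\<close> differs from the cofactor sign by a factor that does not depend on
    \<open>j\<close> and leaves the sum.\<close>
  have sign: "(-1) ^ Suc j = (-1) ^ Suc a * (-1 :: real) ^ (a + j)" for j
    by (simp add: power_add flip: mult.assoc power_mult_distrib)
  have "chi_bar K d r \<sigma> (\<sigma> i) = (\<Sum>j=1..r. ((-1) ^ j * Determinant.det
       (submatrix_along xs L (set xs - {\<sigma> i}) (set xs - {\<sigma> j}))) *\<^sub>R column (\<sigma> j) L)"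
    by (simp only: chi_bar_def Let_def set matrix_vector_mult_basis flip: xs_def L_def)
  then have "chi_bar K d r \<sigma> (\<sigma> i) $ (\<sigma> k) =
    (\<Sum>j<r. (-1) ^ Suc j * Determinant.det
       (submatrix_along xs L (set xs - {xs ! a}) (set xs - {xs ! j})) * L $ (xs ! b) $ (xs ! j))"
    by (simp add: sum.atLeast1_atMost_eq nth a b column_def)
  also have "\<dots> = (\<Sum>j<r. (-1) ^ Suc a * (A $$ (b, j) * cofactor A a j))"
    using a b dist
    by (intro sum.cong refl, subst sign)
      (simp add: submatrix_along_delete submatrix_along_index len cofactor_def flip: A_def;
       simp add: A_def submatrix_along_index len)
  also have "\<dots> = (-1) ^ Suc a * (if a = b then Determinant.det A else 0)"
    by (simp only: row_times_cofactors[OF A a(2) b(2)] flip: sum_distrib_left)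
  finally show ?thesis
    unfolding xs_def[symmetric] L_def[symmetric] using a b by (auto simp: A_def set)
qed

text \<open>\<open>Cut\<close> is the image of the \<open>(k - 1)\<close>-chains only, not of all of
  \<open>real ^ 'c\<close>. The zero rows of \<open>boundary\<close> ensure that the boundary of a
  cell is such a chain.\<close>

lemma column_boundary_in_chains: "column e (boundary K k) \<in> chains K (k - 1)"
proof -
  have "column e (boundary K k) = (\<Sum>i\<in>UNIV. column e (boundary K k) $ i *s axis i 1)"
    by (simp add: basis_expansion)
  also have "\<dots> \<in> chains K (k - 1)"
    unfolding chains_def
  proof (rule span_sum)
    fix i
    show "column e (boundary K k) $ i *s axis i 1 \<in> span ((\<lambda>e. axis e 1) ` cells K (k - 1))"
      by (cases "i \<in> cells K (k - 1)")
        (auto simp: column_def boundary_def scalar_mult_eq_scaleR intro: span_scale span_base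
          span_zero)
  qed
  finally show ?thesis .
qed

lemma subspace_Cut: "subspace (Cut K k)"
  unfolding Cut_def chains_def
  by (intro linear_subspace_image matrix_vector_mul_linear subspace_span)

text \<open>The cut space lies in the row space of the boundary matrix, and row rank equals column
  rank.\<close>

lemma dim_Cut_le: "dim (Cut K k) \<le> rank (boundary K k)"
proof -
  have "dim (Cut K k) \<le>
      dim (range (\<lambda>x. Finite_Cartesian_Product.transpose (boundary K k) *v x))"
    unfolding Cut_def by (intro dim_subset) auto
  then show ?thesis
    by (metis rank_dim_range rank_transpose)
qed

text \<open>Each Laplacian column is the coboundary of the boundary of a cell, and the cut space is
  closed under linear combinations.\<close>

lemma chi_bar_in_Cut: "chi_bar K k r \<sigma> \<tau> \<in> Cut K k"
proof -
  have "Ldu K k *v axis e 1 \<in> Cut K k" for e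
    unfolding Cut_def Ldu_def matrix_vector_mul_assoc[symmetric]
    by (simp add: matrix_vector_mult_basis column_boundary_in_chains)
  then show ?thesis
    unfolding chi_bar_def Let_def by (intro subspace_sum subspace_scale subspace_Cut)
qed

text \<open>Only the coordinates in \<open>I\<close> are controlled; the vectors may be arbitrary
  elsewhere. Coordinate \<open>i\<close> of a linear relation isolates the coefficient of
  \<open>F i\<close>, and the dimension bound turns independence into spanning.\<close>

lemma indexed_basis_diagonal:
  fixes F :: "'n \<Rightarrow> real ^ 'n"
  assumes "subspace V" and V: "\<And>i. i \<in> I \<Longrightarrow> F i \<in> V" and dim: "dim V \<le> card I"
    and diag: "\<And>i k. i \<in> I \<Longrightarrow> k \<in> I \<Longrightarrow> F i $ k = (if k = i then c i else 0)"
    and nz: "\<And>i. i \<in> I \<Longrightarrow> c i \<noteq> 0"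
  shows "indexed_basis I F V"
proof -
  have inj: "inj_on F I"
    by (rule inj_onI) (metis diag nz)
  have indep: "independent (F ` I)"
  proof
    assume "dependent (F ` I)"
    then obtain u i where u: "(\<Sum>v\<in>F ` I. u v *\<^sub>R v) = 0" and i: "i \<in> I" "u (F i) \<noteq> 0"
      by (auto simp: dependent_finite)
    have "0 = (\<Sum>j\<in>I. u (F j) *\<^sub>R F j) $ i"
      using u inj by (simp add: sum.reindex)
    also have "\<dots> = (\<Sum>j\<in>I. if j = i then u (F i) * c i else 0)"
      unfolding sum_component by (rule sum.cong) (auto simp: diag i)
    also have "\<dots> = u (F i) * c i"
      using i by simp
    finally show False
      using i nz by simp
  qed
  have sub: "F ` I \<subseteq> V"
    using V by auto
  have "V \<subseteq> span (F ` I)"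
    using sub indep dim inj by (intro card_ge_dim_independent) (auto simp: card_image)
  moreover have "span (F ` I) \<subseteq> V"
    using sub \<open>subspace V\<close> by (rule span_minimal)
  ultimately show ?thesis
    using inj indep by (auto simp: indexed_basis_def)
qed

theorem theorem4p7:
  fixes K :: "('a, 'c::finite) cw" and d r :: nat
    and S \<Upsilon> :: "'c set" and \<sigma> :: "nat \<Rightarrow> 'c"
  assumes "finite_CW_complex K"
    and "cw_dim K = int d"
    and "r = rank (boundary K (int d))"
    and "cellular_spanning_forest K S"
    and "\<Upsilon> = S \<inter> cells K (int d)"
    and "bij_betw \<sigma> {1..r} \<Upsilon>"
  shows "indexed_basis \<Upsilon> (chi_bar K (int d) r \<sigma>) (Cut K (int d))"
proof -
  let ?xs = "map \<sigma> [1..<Suc r]"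
  define D where "D = Determinant.det (submatrix_along ?xs (Ldu K (int d)) \<Upsilon> \<Upsilon>)"
  have inj: "inj_on \<sigma> {1..r}" and img: "\<sigma> ` {1..r} = \<Upsilon>"
    using assms(6) by (auto simp: bij_betw_def)
  have card: "card \<Upsilon> = r"
    using bij_betw_same_card[OF assms(6)] by simp
  have set: "set ?xs = \<Upsilon>"
    using img by (simp add: atLeastLessThanSuc_atLeastAtMost del: upt_Suc)
  have dist: "distinct ?xs"
    using inj by (simp add: distinct_map atLeastLessThanSuc_atLeastAtMost del: upt_Suc)
  \<comment> \<open>The forest condition supplies the distinct, independent columns that the Gram
    argument needs.\<close>
  have "D \<noteq> 0"
    using gram_submatrix_det_nonzero[OF dist, of "boundary K (int d)", unfolded set]
      assms(2,4,5)
    by (simp add: D_def Ldu_def cellular_spanning_forest_def indexed_basis_def)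
  \<comment> \<open>The diagonal entry as a function of the facet: \<open>inv_into\<close> recovers
    the index that determines the sign.\<close>
  define c where "c \<tau> = (-1) ^ inv_into {1..r} \<sigma> \<tau> * D" for \<tau>
  have "chi_bar K (int d) r \<sigma> \<tau> $ \<rho> = (if \<rho> = \<tau> then c \<tau> else 0)"
    if mem: "\<tau> \<in> \<Upsilon>" "\<rho> \<in> \<Upsilon>" for \<tau> \<rho>
  proof -
    obtain i k where "i \<in> {1..r}" "\<tau> = \<sigma> i" "k \<in> {1..r}" "\<rho> = \<sigma> k"
      using mem unfolding img[symmetric] by blast
    then show ?thesis
      using chi_bar_coordinates[OF inj, of i k K "int d", unfolded img] inj inj_on_eq_iff[OF inj, of k i]
      by (simp add: c_def D_def inv_into_f_f del: upt_Suc)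
  qed
  \<comment> \<open>The rank of the boundary map is the number of forest facets, which gives the
    dimension bound.\<close>
  then show ?thesis
    using \<open>D \<noteq> 0\<close> dim_Cut_le[of K "int d"] assms(3) card
    by (intro indexed_basis_diagonal[where c = c] subspace_Cut chi_bar_in_Cut)
      (auto simp: c_def)
qed

end
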